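(* Let $n\ge 2$, let $t\in\mathbb{R}$ with $1\le t<\sqrt n$, and let $\mathbf v\in\mathbb{R}^n$. Consider the problem $$(P)\qquad \text{minimize } \tfrac12\|\mathbf x-\mathbf v\|_2^2 \ \text{ over all } \mathbf x\in\mathbb{R}^n_+ \text{ with } \|\mathbf x\|_1=t,\ \|\mathbf x\|_2=1 .$$ Then the following hold: (i) If $I_1>t^2$, the solution of $(P)$ is not unique, and any solution $\mathbf x$ of the system $$\sum_{i\in\mathcal I_1}x_i=t,\quad \sum_{i\in\mathcal I_1}x_i^2=1,\quad x_i\ge 0\ (i\in\mathcal I_1),\quad x_i=0\ (i\notin\mathcal I_1)\qquad ( * )$$ solves $(P)$. (ii) If $I_1=t^2$, then $(P)$ has the unique solution given by $x_i=1/\sqrt{I_1}$ for $i\in\mathcal I_1$ and $x_i=0$ for $i\notin\mathcal I_1$, which is also the unique solution of $( * )$. (iii) If $I_1<t^2$, then $(P)$ has the unique solution $\mathbf x=(\mathbf v-\lambda^*\mathbf 1)^+/\|(\mathbf v-\lambda^*\mathbf 1)^+\|_2$, where $\lambda^*$ is the unique root of $\phi(\lambda)=0$ on $(-\infty,v_{\max})$.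
   Context: $\mathbb{R}^n_+$ is the nonnegative orthant; $\mathbf 1\in\mathbb{R}^n$ is the all-ones vector; for a vector $\mathbf y$, $\mathbf y^+=\max(\mathbf y,0)$ componentwise; $v_{\max}=\max_i v_i$. $\mathcal I_1=\{i: v_i=v_{\max}\}$ and $I_1=|\mathcal I_1|$. For $\lambda\in\mathbb{R}$, $$\phi(\lambda)=\|(\mathbf v-\lambda\mathbf 1)^+\|_1^2-t^2\|(\mathbf v-\lambda\mathbf 1)^+\|_2^2 .$$ *)

theory Defs
  imports "HOL-Analysis.Analysis"
begin

definition l1_norm :: "real ^ 'n \<Rightarrow> real" where
  "l1_norm x = (\<Sum>i\<in>UNIV. \<bar>x $ i\<bar>)"

definition pos_part :: "real ^ 'n \<Rightarrow> real ^ 'n" where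
  "pos_part y = (\<chi> i. max (y $ i) 0)"

definition vmax :: "real ^ 'n \<Rightarrow> real" where
  "vmax v = Max (range (\<lambda>i. v $ i))"

definition max_indices :: "real ^ 'n \<Rightarrow> 'n set" where
  "max_indices v = {i. v $ i = vmax v}"

(* Here 1 is the all-ones vector, the componentwise one of type real ^ 'n. *)
definition phi :: "real ^ 'n \<Rightarrow> real \<Rightarrow> real \<Rightarrow> real" where
  "phi v t l = (l1_norm (pos_part (v - l *\<^sub>R 1)))\<^sup>2 - t\<^sup>2 * (norm (pos_part (v - l *\<^sub>R 1)))\<^sup>2"

definition feasible :: "real \<Rightarrow> real ^ 'n \<Rightarrow> bool" where
  "feasible t x \<longleftrightarrow> (\<forall>i. 0 \<le> x $ i) \<and> l1_norm x = t \<and> norm x = 1"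

definition solves_P :: "real ^ 'n \<Rightarrow> real \<Rightarrow> real ^ 'n \<Rightarrow> bool" where
  "solves_P v t x \<longleftrightarrow> is_arg_min (\<lambda>y. 1/2 * (norm (y - v))\<^sup>2) (feasible t) x"

definition solves_system :: "real ^ 'n \<Rightarrow> real \<Rightarrow> real ^ 'n \<Rightarrow> bool" where
  "solves_system v t x \<longleftrightarrow>
     (\<Sum>i\<in>max_indices v. x $ i) = t \<and>
     (\<Sum>i\<in>max_indices v. (x $ i)\<^sup>2) = 1 \<and>
     (\<forall>i\<in>max_indices v. 0 \<le> x $ i) \<and>
     (\<forall>i. i \<notin> max_indices v \<longrightarrow> x $ i = 0)"

end

theory Submission
  imports Defs
begin

text \<open>
  On the unit sphere \<open>\<parallel>x - v\<parallel>\<^sup>2 / 2\<close> equals \<open>(1 + \<parallel>v\<parallel>\<^sup>2) / 2 - v \<bullet> x\<close>, so the problem is to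
  maximise the linear functional \<open>v \<bullet> x\<close> (\<open>solves_P_iff_inner_max\<close>).  Two upper bounds for it
  settle the three cases.

  Since a feasible \<open>x\<close> is nonnegative with entries summing to \<open>t\<close>, we have \<open>v \<bullet> x \<le> v\<^sub>m\<^sub>a\<^sub>x t\<close>, and
  equality means that \<open>x\<close> lives on the indices where \<open>v\<close> is maximal.  The points of equality
  are therefore exactly the solutions of the system \<open>(*)\<close>
  (\<open>solves_system_iff_inner_eq\<close>), and as soon as the system is solvable it describes all
  minimisers.  By Cauchy--Schwarz it can only be solvable if \<open>I\<^sub>1 \<ge> t\<^sup>2\<close>.  If \<open>I\<^sub>1 = t\<^sup>2\<close>, its only
  solution is the constant vector on the maximal indices.  If \<open>I\<^sub>1 > t\<^sup>2\<close>, one coordinate can be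
  raised above the mean \<open>t / I\<^sub>1\<close> and all others lowered evenly; the freedom in choosing this
  coordinate gives several solutions.

  If \<open>I\<^sub>1 < t\<^sup>2\<close>, shift by a multiplier \<open>l\<close>: with \<open>w = (v - l 1)\<^sup>+\<close>,
  every feasible \<open>x\<close> satisfies \<open>v \<bullet> x = l t + (v - l 1) \<bullet> x \<le> l t + w \<bullet> x \<le> l t + \<parallel>w\<parallel>\<close>, with
  equality only at \<open>x = w / \<parallel>w\<parallel>\<close>.  That point is feasible precisely when \<open>\<phi>(l) = 0\<close>, so every
  root of \<open>\<phi>\<close> below \<open>v\<^sub>m\<^sub>a\<^sub>x\<close> yields the unique minimiser (\<open>solves_P_iff_of_root\<close>).
  A root exists by the intermediate value theorem: \<open>\<phi>\<close> is negative at the second largest value of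
  \<open>v\<close>, where \<open>w\<close> is constant on the maximal indices and 0 elsewhere, and nonnegative far to the
  left, where \<open>w\<close> is nearly a multiple of the all-ones vector and \<open>t\<^sup>2 < n\<close>.  Uniqueness of the root is a consequence
  of uniqueness of the minimiser: two roots give proportional vectors \<open>w\<close>, the positive entries
  of \<open>w\<close> come from at least two distinct values of \<open>v\<close>, and these values determine the
  shift.
\<close>

section \<open>Reduction to maximising a linear functional\<close>

lemma l1_norm_eq_sum:
  fixes x :: "real ^ 'n"
  assumes "\<And>i. 0 \<le> x $ i"
  shows "l1_norm x = (\<Sum>i\<in>UNIV. x $ i)"
  using assms by (simp add: l1_norm_def)

lemma power2_norm_eq_sum:
  fixes x :: "real ^ 'n"
  shows "(norm x)\<^sup>2 = (\<Sum>i\<in>UNIV. (x $ i)\<^sup>2)"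
  by (simp add: norm_vec_def L2_set_def sum_nonneg)

lemma norm_eq_1_iff_sum:
  fixes x :: "real ^ 'n"
  shows "norm x = 1 \<longleftrightarrow> (\<Sum>i\<in>UNIV. (x $ i)\<^sup>2) = 1"
  using power2_norm_eq_sum[of x] norm_ge_zero[of x]
  by (metis abs_norm_cancel abs_square_eq_1 power_one)

lemma feasible_sum:
  fixes x :: "real ^ 'n"
  assumes "feasible t x"
  shows "(\<Sum>i\<in>UNIV. x $ i) = t"
  using assms l1_norm_eq_sum[of x] by (auto simp: feasible_def)

lemma solves_P_iff_inner_max:
  fixes v x :: "real ^ 'n"
  shows "solves_P v t x \<longleftrightarrow> feasible t x \<and> (\<forall>y. feasible t y \<longrightarrow> v \<bullet> y \<le> v \<bullet> x)"
proof -
  have obj: "1/2 * (norm (y - v))\<^sup>2 = 1/2 * (1 + (norm v)\<^sup>2) - v \<bullet> y"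
    if "feasible t y" for y
  proof -
    have "y \<bullet> y = 1"
      using that by (simp add: feasible_def dot_square_norm)
    then show ?thesis
      by (simp add: power2_norm_eq_inner inner_diff_left inner_diff_right inner_commute)
  qed
  show ?thesis
    unfolding solves_P_def is_arg_min_def using obj by (smt (verit))
qed

section \<open>The bound by the largest entry\<close>

lemma le_vmax:
  fixes v :: "real ^ 'n"
  shows "v $ i \<le> vmax v"
  by (simp add: vmax_def)

lemma max_indices_nonempty:
  fixes v :: "real ^ 'n"
  shows "max_indices v \<noteq> {}"
proof -
  have "vmax v \<in> range (\<lambda>i. v $ i)"
    unfolding vmax_def by (rule Max_in) auto
  then show ?thesis
    by (auto simp: max_indices_def)
qed

lemma vmax_gap:
  fixes v x :: "real ^ 'n"
  assumes "feasible t x"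
  shows "vmax v * t - v \<bullet> x = (\<Sum>i\<in>UNIV. (vmax v - v $ i) * x $ i)"
  using feasible_sum[OF assms]
  by (simp add: inner_vec_def left_diff_distrib sum_subtractf flip: sum_distrib_left)

lemma inner_le_vmax:
  fixes v x :: "real ^ 'n"
  assumes "feasible t x"
  shows "v \<bullet> x \<le> vmax v * t"
proof -
  have "0 \<le> (\<Sum>i\<in>UNIV. (vmax v - v $ i) * x $ i)"
    using assms by (intro sum_nonneg mult_nonneg_nonneg) (auto simp: le_vmax feasible_def)
  then show ?thesis
    using vmax_gap[OF assms, of v] by linarith
qed

text \<open>
  The gap in the bound is a sum of the nonnegative terms \<open>(v\<^sub>m\<^sub>a\<^sub>x - v\<^sub>i) x\<^sub>i\<close>; it closes iff each
  term vanishes, that is, iff \<open>x\<close> is supported on the maximal indices.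
\<close>

lemma solves_system_iff_inner_eq:
  fixes v x :: "real ^ 'n"
  shows "solves_system v t x \<longleftrightarrow> feasible t x \<and> v \<bullet> x = vmax v * t"
proof
  assume sys: "solves_system v t x"
  have nonneg: "0 \<le> x $ i" for i
    using sys by (cases "i \<in> max_indices v") (auto simp: solves_system_def)
  have "(\<Sum>i\<in>UNIV. x $ i) = (\<Sum>i\<in>max_indices v. x $ i)"
    using sys by (intro sum.mono_neutral_right) (auto simp: solves_system_def)
  moreover have "(\<Sum>i\<in>UNIV. (x $ i)\<^sup>2) = (\<Sum>i\<in>max_indices v. (x $ i)\<^sup>2)"
    using sys by (intro sum.mono_neutral_right) (auto simp: solves_system_def)
  ultimately have feas: "feasible t x"
    using sys nonneg l1_norm_eq_sum[of x]
    by (auto simp: feasible_def solves_system_def norm_eq_1_iff_sum)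
  have "(\<Sum>i\<in>UNIV. (vmax v - v $ i) * x $ i) = 0"
    using sys by (intro sum.neutral) (force simp: solves_system_def max_indices_def)
  with feas vmax_gap[OF feas, of v] show "feasible t x \<and> v \<bullet> x = vmax v * t"
    by simp
next
  assume *: "feasible t x \<and> v \<bullet> x = vmax v * t"
  then have nonneg: "0 \<le> x $ i" for i
    by (simp add: feasible_def)
  have "(\<Sum>i\<in>UNIV. (vmax v - v $ i) * x $ i) = 0"
    using * vmax_gap[of t x v] by simp
  then have "(vmax v - v $ i) * x $ i = 0" for i
    using nonneg by (subst (asm) sum_nonneg_eq_0_iff) (auto simp: le_vmax)
  then have supp: "x $ i = 0" if "i \<notin> max_indices v" for i
    using that by (metis (mono_tags) eq_iff_diff_eq_0 max_indices_def mem_Collect_eq mult_eq_0_iff)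
  have "(\<Sum>i\<in>UNIV. x $ i) = (\<Sum>i\<in>max_indices v. x $ i)"
    using supp by (intro sum.mono_neutral_right) auto
  moreover have "(\<Sum>i\<in>UNIV. (x $ i)\<^sup>2) = (\<Sum>i\<in>max_indices v. (x $ i)\<^sup>2)"
    using supp by (intro sum.mono_neutral_right) auto
  ultimately show "solves_system v t x"
    using * nonneg supp feasible_sum[of t x]
    by (auto simp: solves_system_def feasible_def norm_eq_1_iff_sum)
qed

lemma solves_P_iff_solves_system:
  fixes v z :: "real ^ 'n"
  assumes "solves_system v t z"
  shows "solves_P v t x \<longleftrightarrow> solves_system v t x"
  using assms inner_le_vmax[of t _ v]
  unfolding solves_P_iff_inner_max solves_system_iff_inner_eq
  by (metis order_antisym)

section \<open>Solutions of the system\<close>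

text \<open>
  The constant vector with sum \<open>t\<close> on \<open>k\<close> indices has \<open>t\<^sup>2 / k\<close> as its sum of squares.  Lowering
  \<open>k - 1\<close> entries by \<open>d\<close> and raising the remaining one by \<open>(k - 1) d\<close> keeps the sum and adds
  \<open>k (k - 1) d\<^sup>2\<close> to the sum of squares; this \<open>d\<close> makes the latter 1.
\<close>

definition spike_drop :: "'n set \<Rightarrow> real \<Rightarrow> real" where
  "spike_drop S t = sqrt ((1 - t\<^sup>2 / card S) / (card S * (real (card S) - 1)))"

definition spike :: "'n::finite set \<Rightarrow> real \<Rightarrow> 'n \<Rightarrow> real ^ 'n" where
  "spike S t j = (\<chi> i. if i = j then t / card S + (real (card S) - 1) * spike_drop S t
                      else if i \<in> S then t / card S - spike_drop S t else 0)"

lemma sum_over_spike: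
  fixes j :: "'n::finite" and f :: "real \<Rightarrow> real"
  assumes "j \<in> S"
  shows "(\<Sum>i\<in>S. f (spike S t j $ i)) =
           f (t / card S + (real (card S) - 1) * spike_drop S t)
           + (real (card S) - 1) * f (t / card S - spike_drop S t)"
proof -
  have "(\<Sum>i\<in>S - {j}. f (spike S t j $ i)) =
          (\<Sum>i\<in>S - {j}. f (t / card S - spike_drop S t))"
    by (intro sum.cong) (auto simp: spike_def)
  moreover have "card S \<ge> 1"
    using assms by (simp add: Suc_le_eq card_gt_0_iff) blast
  ultimately have "(\<Sum>i\<in>S - {j}. f (spike S t j $ i)) =
                     (real (card S) - 1) * f (t / card S - spike_drop S t)"
    using assms by (simp add: of_nat_diff)
  then show ?thesis
    using assms by (simp add: sum.remove[of S j] spike_def)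
qed

lemma sum_spike:
  fixes j :: "'n::finite"
  assumes "j \<in> S"
  shows "(\<Sum>i\<in>S. spike S t j $ i) = t"
proof -
  have "card S \<noteq> 0"
    using assms by auto
  then show ?thesis
    using sum_over_spike[OF assms, of "\<lambda>r. r" t] by (simp add: field_simps)
qed

lemma spike_drop_squared:
  fixes t :: real
  assumes "card S \<ge> 2" and "t\<^sup>2 < card S"
  shows "(spike_drop S t)\<^sup>2 = (1 - t\<^sup>2 / card S) / (card S * (real (card S) - 1))"
  using assms by (simp add: spike_drop_def)

lemma sum_spike_squares:
  fixes j :: "'n::finite" and t :: real
  assumes "j \<in> S" and "card S \<ge> 2" and "t\<^sup>2 < card S"
  shows "(\<Sum>i\<in>S. (spike S t j $ i)\<^sup>2) = 1"
proof -
  define k d where "k = real (card S)" and "d = spike_drop S t"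
  have k: "k \<ge> 2"
    using assms by (simp add: k_def)
  \<comment> \<open>The cross terms cancel: deviations from the mean sum to 0.\<close>
  have "(\<Sum>i\<in>S. (spike S t j $ i)\<^sup>2) = (t / k + (k - 1) * d)\<^sup>2 + (k - 1) * (t / k - d)\<^sup>2"
    using sum_over_spike[OF assms(1), of "\<lambda>r. r\<^sup>2" t] by (simp add: k_def d_def)
  also have "\<dots> = k * (t / k)\<^sup>2 + k * (k - 1) * d\<^sup>2"
    by algebra
  also have "k * (t / k)\<^sup>2 = t\<^sup>2 / k"
    using k by (simp add: power2_eq_square)
  also have "d\<^sup>2 = (1 - t\<^sup>2 / k) / (k * (k - 1))"
    using spike_drop_squared[OF assms(2,3)] by (simp add: k_def d_def)
  also have "t\<^sup>2 / k + k * (k - 1) * \<dots> = 1"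
    using k by simp
  finally show ?thesis .
qed

text \<open>
  Lowering the entries keeps them nonnegative exactly because \<open>t \<ge> 1\<close>.
\<close>

lemma spike_drop_le_mean:
  fixes t :: real
  assumes "card S \<ge> 2" and "1 \<le> t" and "t\<^sup>2 < card S"
  shows "spike_drop S t \<le> t / card S"
proof (rule power2_le_imp_le)
  define k where "k = real (card S)"
  have k: "k \<ge> 2"
    using assms by (simp add: k_def)
  have "1 * k \<le> t\<^sup>2 * k"
    using assms k by (intro mult_right_mono) (auto simp: one_le_power)
  then have "(1 - t\<^sup>2 / k) / (k * (k - 1)) \<le> (t / k)\<^sup>2"
    using k by (simp add: field_simps power2_eq_square)
  then show "(spike_drop S t)\<^sup>2 \<le> (t / card S)\<^sup>2"
    using spike_drop_squared[OF assms(1,3)] by (simp add: k_def)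
qed (use assms in simp)

lemma solves_system_spike:
  fixes v :: "real ^ 'n" and t :: real
  assumes "j \<in> max_indices v" and "card (max_indices v) \<ge> 2"
    and "1 \<le> t" and "t\<^sup>2 < card (max_indices v)"
  shows "solves_system v t (spike (max_indices v) t j)"
proof -
  have "spike_drop (max_indices v) t \<ge> 0"
    using assms by (simp add: spike_drop_def)
  then have "0 \<le> spike (max_indices v) t j $ i" for i
    using assms spike_drop_le_mean[OF assms(2,3,4)] by (auto simp: spike_def)
  moreover have "spike (max_indices v) t j $ i = 0" if "i \<notin> max_indices v" for i
    using that assms by (auto simp: spike_def)
  ultimately show ?thesis
    using assms by (auto simp: solves_system_def sum_spike sum_spike_squares)
qed

lemma spike_inj:
  fixes i j :: "'n::finite" and t :: real
  assumes "i \<in> S" "i \<noteq> j" and "card S \<ge> 2" and "t\<^sup>2 < card S"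
  shows "spike S t i \<noteq> spike S t j"
proof
  assume "spike S t i = spike S t j"
  then have "spike S t i $ i = spike S t j $ i"
    by simp
  then have "real (card S) * spike_drop S t = 0"
    using assms by (simp add: spike_def algebra_simps)
  moreover have "spike_drop S t > 0"
    using assms by (simp add: spike_drop_def)
  ultimately show False
    using assms by simp
qed

text \<open>
  This is the equality case of Cauchy--Schwarz: for \<open>k = t\<^sup>2\<close> maximal indices the sum of
  \<open>(x\<^sub>i - 1 / \<surd>k)\<^sup>2\<close> over them is \<open>1 - 2 t / \<surd>k + 1 = 0\<close>.
\<close>

lemma solves_system_iff_uniform:
  fixes v y :: "real ^ 'n"
  assumes "t \<ge> 0" and card: "real (card (max_indices v)) = t\<^sup>2"
  shows "solves_system v t y \<longleftrightarrow>
           y = (\<chi> i. if i \<in> max_indices v then 1 / sqrt (real (card (max_indices v))) else 0)"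
    (is "_ \<longleftrightarrow> y = ?u")
proof
  have "card (max_indices v) \<noteq> 0"
    using max_indices_nonempty[of v] by simp
  then have t: "t > 0"
    using assms by (cases "t = 0") auto
  have root: "sqrt (real (card (max_indices v))) = t"
    using assms by simp
  {
    assume sys: "solves_system v t y"
    have "(\<Sum>i\<in>max_indices v. (y $ i - 1 / t)\<^sup>2) =
            (\<Sum>i\<in>max_indices v. (y $ i)\<^sup>2) - 2 / t * (\<Sum>i\<in>max_indices v. y $ i)
            + (\<Sum>i\<in>max_indices v. (1 / t)\<^sup>2)"
      by (simp only: power2_diff sum.distrib sum_subtractf sum_distrib_left)
         (simp add: mult_ac)
    also have "\<dots> = 0"
      using sys t card by (simp add: solves_system_def power_divide)
    finally have "y $ i = 1 / t" if "i \<in> max_indices v" for i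
      using that by (subst (asm) sum_nonneg_eq_0_iff) auto
    then show "y = ?u"
      using sys by (auto simp: vec_eq_iff solves_system_def root)
  next
    assume "y = ?u"
    then show "solves_system v t y"
      using t card by (simp add: solves_system_def root power_divide power2_eq_square)
  }
qed

section \<open>Shifting by a multiplier\<close>

lemma pos_part_shift_nth [simp]:
  fixes v :: "real ^ 'n"
  shows "pos_part (v - l *\<^sub>R 1) $ i = max (v $ i - l) 0"
  by (simp add: pos_part_def)

lemma phi_eq_sums:
  fixes v :: "real ^ 'n"
  shows "phi v t l = (\<Sum>i\<in>UNIV. max (v $ i - l) 0)\<^sup>2 - t\<^sup>2 * (\<Sum>i\<in>UNIV. (max (v $ i - l) 0)\<^sup>2)"
  by (simp add: phi_def l1_norm_eq_sum power2_norm_eq_sum)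

lemma norm_pos_part_pos:
  fixes v :: "real ^ 'n"
  assumes "l < vmax v"
  shows "norm (pos_part (v - l *\<^sub>R 1)) > 0"
proof -
  obtain i where "v $ i = vmax v"
    using max_indices_nonempty[of v] by (auto simp: max_indices_def)
  with assms have "pos_part (v - l *\<^sub>R 1) $ i \<noteq> 0"
    by simp
  then show ?thesis
    by (metis zero_less_norm_iff zero_index)
qed

lemma feasible_of_root:
  fixes v :: "real ^ 'n"
  assumes "t \<ge> 0" and "l < vmax v" and "phi v t l = 0"
  shows "feasible t (pos_part (v - l *\<^sub>R 1) /\<^sub>R norm (pos_part (v - l *\<^sub>R 1)))"
proof -
  define w where "w = pos_part (v - l *\<^sub>R 1)"
  have w: "norm w > 0"
    using norm_pos_part_pos[OF assms(2)] by (simp add: w_def)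
  have "(l1_norm w)\<^sup>2 = (t * norm w)\<^sup>2"
    using assms(3) by (simp add: phi_def w_def power_mult_distrib)
  moreover have "l1_norm w \<ge> 0"
    by (simp add: l1_norm_def sum_nonneg)
  ultimately have "l1_norm w = t * norm w"
    using assms(1) by simp
  moreover have "l1_norm (w /\<^sub>R norm w) = l1_norm w / norm w"
    by (simp add: l1_norm_def abs_mult divide_inverse_commute sum_distrib_left)
  ultimately have "l1_norm (w /\<^sub>R norm w) = t"
    using w by simp
  moreover have "norm (w /\<^sub>R norm w) = 1"
    using w by simp
  moreover have "0 \<le> (w /\<^sub>R norm w) $ i" for i
    using w by (simp add: w_def)
  ultimately show ?thesis
    unfolding feasible_def w_def by blast
qed

text \<open>
  The Lagrangian bound.  Cauchy--Schwarz for the unit vector \<open>y\<close> is strict unless \<open>y\<close> is the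
  normalised \<open>w\<close>.
\<close>

lemma inner_le_shift:
  fixes v y :: "real ^ 'n"
  assumes "feasible t y" and "l < vmax v"
  defines "w \<equiv> pos_part (v - l *\<^sub>R 1)"
  shows "v \<bullet> y \<le> l * t + norm w"
    and "v \<bullet> y = l * t + norm w \<Longrightarrow> y = w /\<^sub>R norm w"
proof -
  have w: "norm w > 0"
    using norm_pos_part_pos[OF assms(2)] by (simp add: w_def)
  have y: "norm y = 1"
    using assms(1) by (simp add: feasible_def)
  have "v \<bullet> y = l * t + (\<Sum>i\<in>UNIV. (v $ i - l) * y $ i)"
    using feasible_sum[OF assms(1)]
    by (simp add: inner_vec_def left_diff_distrib sum_subtractf flip: sum_distrib_left)
  also have "(\<Sum>i\<in>UNIV. (v $ i - l) * y $ i) \<le> w \<bullet> y"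
    unfolding inner_vec_def w_def
    using assms(1) by (auto intro!: sum_mono mult_right_mono simp: feasible_def)
  finally have le: "v \<bullet> y \<le> l * t + w \<bullet> y"
    by simp
  have cs: "w \<bullet> y \<le> norm w"
    using norm_cauchy_schwarz[of w y] y by simp
  from le cs show "v \<bullet> y \<le> l * t + norm w"
    by linarith
  show "y = w /\<^sub>R norm w" if "v \<bullet> y = l * t + norm w"
  proof -
    have "w \<bullet> y = norm w * norm y"
      using that le cs y by simp
    then have "norm w *\<^sub>R y = w"
      using norm_cauchy_schwarz_eq[of w y] y by simp
    then have "inverse (norm w) *\<^sub>R (norm w *\<^sub>R y) = w /\<^sub>R norm w"
      by simp
    then show ?thesis
      using w by simp
  qed
qed

text \<open>
  The normalised \<open>w = (v - l 1)\<^sup>+\<close> attains the Lagrangian bound because \<open>v - l 1\<close> and \<open>w\<close> agree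
  wherever \<open>w\<close> is nonzero; it is feasible because \<open>l\<close> is a root.
\<close>

lemma solves_P_iff_of_root:
  fixes v :: "real ^ 'n"
  assumes "t \<ge> 0" and "l < vmax v" and "phi v t l = 0"
  shows "solves_P v t y \<longleftrightarrow>
           y = pos_part (v - l *\<^sub>R 1) /\<^sub>R norm (pos_part (v - l *\<^sub>R 1))"
proof -
  define w where "w = pos_part (v - l *\<^sub>R 1)"
  define x where "x = w /\<^sub>R norm w"
  have w: "norm w > 0"
    using norm_pos_part_pos[OF assms(2)] by (simp add: w_def)
  have feas: "feasible t x"
    using feasible_of_root[OF assms] by (simp add: x_def w_def)
  have "(v - l *\<^sub>R 1) \<bullet> w = w \<bullet> w"
    unfolding inner_vec_def w_def by (intro sum.cong) (auto simp: max_def)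
  then have "(v - l *\<^sub>R 1) \<bullet> x = norm w"
    using w by (simp add: x_def dot_square_norm power2_eq_square)
  moreover have "(1 :: real ^ 'n) \<bullet> x = t"
    using feasible_sum[OF feas] by (simp add: inner_vec_def)
  ultimately have "v \<bullet> x = l * t + norm w"
    by (simp add: inner_diff_left)
  then have "solves_P v t y \<longleftrightarrow> y = x"
    unfolding solves_P_iff_inner_max
    using feas inner_le_shift[OF _ assms(2), of t] unfolding w_def[symmetric] x_def
    by (metis order_antisym)
  then show ?thesis
    by (simp add: x_def w_def)
qed

section \<open>The root of phi\<close>

text \<open>
  Where only the maximal indices survive the shift, \<open>\<phi>(l)\<close> equals \<open>(k\<^sup>2 - t\<^sup>2 k) (v\<^sub>m\<^sub>a\<^sub>x - l)\<^sup>2\<close> for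
  \<open>k\<close> maximal indices, which is negative because \<open>k < t\<^sup>2\<close>.
\<close>

lemma phi_neg_of_support:
  fixes v :: "real ^ 'n"
  assumes "real (card (max_indices v)) < t\<^sup>2" and "l < vmax v"
    and supp: "\<And>i. i \<notin> max_indices v \<Longrightarrow> v $ i \<le> l"
  shows "phi v t l < 0"
proof -
  define k where "k = real (card (max_indices v))"
  have k: "k > 0"
    using max_indices_nonempty[of v] by (simp add: k_def card_gt_0_iff)
  have restrict: "(\<Sum>i\<in>UNIV. f (max (v $ i - l) 0)) = k * f (vmax v - l)"
    if "f 0 = 0" for f :: "real \<Rightarrow> real"
  proof -
    have "(\<Sum>i\<in>UNIV. f (max (v $ i - l) 0)) = (\<Sum>i\<in>max_indices v. f (max (v $ i - l) 0))"
      using supp that by (intro sum.mono_neutral_right) (auto simp: max_def)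
    also have "\<dots> = (\<Sum>i\<in>max_indices v. f (vmax v - l))"
      using assms(2) by (intro sum.cong) (auto simp: max_indices_def)
    finally show ?thesis
      by (simp add: k_def)
  qed
  have "phi v t l = (k * (vmax v - l))\<^sup>2 - t\<^sup>2 * (k * (vmax v - l)\<^sup>2)"
    using restrict[of "\<lambda>r. r"] restrict[of "\<lambda>r. r\<^sup>2"] by (simp add: phi_eq_sums)
  also have "\<dots> = k * (vmax v - l)\<^sup>2 * (k - t\<^sup>2)"
    by (simp add: power2_eq_square algebra_simps)
  also have "\<dots> < 0"
    using assms k by (intro mult_pos_neg) (auto simp: k_def)
  finally show ?thesis .
qed

text \<open>
  All entries of \<open>(v - l 1)\<^sup>+\<close> lie in \<open>[a, a + d]\<close>, so \<open>\<phi>(l) \<ge> (n a)\<^sup>2 - t\<^sup>2 n (a + d)\<^sup>2\<close>, and the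
  last hypothesis says that this bound is nonnegative.
\<close>

lemma phi_nonneg_of_spread:
  fixes v :: "real ^ 'n"
  assumes "t \<ge> 0" and "a \<ge> 0"
    and lower: "\<And>i. l + a \<le> v $ i" and upper: "\<And>i. v $ i \<le> l + a + d"
    and "t * (a + d) \<le> sqrt (real CARD('n)) * a"
  shows "phi v t l \<ge> 0"
proof -
  define n where "n = real CARD('n)"
  have d: "d \<ge> 0"
    using lower[of undefined] upper[of undefined] by linarith
  have bounds: "a \<le> max (v $ i - l) 0" "max (v $ i - l) 0 \<le> a + d" for i
    using lower[of i] upper[of i] \<open>a \<ge> 0\<close> d by auto
  have "(\<Sum>i\<in>UNIV. (max (v $ i - l) 0)\<^sup>2) \<le> (\<Sum>i\<in>(UNIV :: 'n set). (a + d)\<^sup>2)"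
    using bounds by (intro sum_mono power_mono) auto
  then have "t\<^sup>2 * (\<Sum>i\<in>UNIV. (max (v $ i - l) 0)\<^sup>2) \<le> t\<^sup>2 * (n * (a + d)\<^sup>2)"
    by (intro mult_left_mono) (auto simp: n_def)
  also have "\<dots> = n * (t * (a + d))\<^sup>2"
    by (simp add: power_mult_distrib)
  also have "\<dots> \<le> n * (sqrt n * a)\<^sup>2"
    using assms d by (intro mult_left_mono power_mono) (auto simp: n_def)
  also have "\<dots> = (n * a)\<^sup>2"
    by (simp add: n_def power_mult_distrib power2_eq_square)
  also have "\<dots> \<le> (\<Sum>i\<in>UNIV. max (v $ i - l) 0)\<^sup>2"
  proof (rule power_mono)
    have "(\<Sum>i\<in>(UNIV :: 'n set). a) \<le> (\<Sum>i\<in>UNIV. max (v $ i - l) 0)"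
      using bounds by (intro sum_mono) auto
    then show "n * a \<le> (\<Sum>i\<in>UNIV. max (v $ i - l) 0)"
      by (simp add: n_def)
  qed (use assms in \<open>simp add: n_def\<close>)
  finally show ?thesis
    by (simp add: phi_eq_sums)
qed

lemma phi_root_exists:
  fixes v :: "real ^ 'n"
  assumes "t \<ge> 0" and t: "t < sqrt (real CARD('n))"
    and card: "real (card (max_indices v)) < t\<^sup>2"
  shows "\<exists>l < vmax v. phi v t l = 0"
proof -
  have "t\<^sup>2 < real CARD('n)"
    using assms by (metis real_sqrt_less_iff real_sqrt_unique)
  with card have "max_indices v \<noteq> UNIV"
    by auto
  then have others: "(\<lambda>i. v $ i) ` (- max_indices v) \<noteq> {}"
    by auto
  \<comment> \<open>The right end is the second largest value of \<open>v\<close>.\<close>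
  define hi where "hi = Max ((\<lambda>i. v $ i) ` (- max_indices v))"
  have "hi \<in> (\<lambda>i. v $ i) ` (- max_indices v)"
    unfolding hi_def using others by (intro Max_in) auto
  then obtain j where j: "j \<notin> max_indices v" "hi = v $ j"
    by auto
  then have hi: "hi < vmax v"
    using le_vmax[of v j] by (auto simp: max_indices_def)
  have "v $ i \<le> hi" if "i \<notin> max_indices v" for i
    unfolding hi_def using that by (intro Max_ge) auto
  then have "phi v t hi < 0"
    using phi_neg_of_support[OF card hi] by blast
  \<comment> \<open>The entries of \<open>v\<close> lie in an interval of length \<open>2 B\<close>; \<open>a\<close> solves
     \<open>t (a + 2 B) = \<surd>n a\<close>.\<close>
  define B where "B = norm v"
  define a where "a = 2 * t * B / (sqrt (real CARD('n)) - t)"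
  define lo where "lo = - B - a"
  have entry: "- B \<le> v $ i" "v $ i \<le> B" for i
    using component_le_norm_cart[of v i] by (auto simp: B_def)
  have a: "a \<ge> 0"
    using assms by (simp add: a_def B_def)
  have "(sqrt (real CARD('n)) - t) * a = 2 * t * B"
    using t by (simp add: a_def)
  then have "t * (a + 2 * B) \<le> sqrt (real CARD('n)) * a"
    by (simp add: algebra_simps)
  then have "phi v t lo \<ge> 0"
    using entry a assms(1) by (intro phi_nonneg_of_spread[where a = a and d = "2 * B"])
      (auto simp: lo_def)
  have "lo \<le> hi"
    using entry[of j] j a by (simp add: lo_def)
  have "continuous_on {lo..hi} (phi v t)"
    unfolding phi_eq_sums by (intro continuous_intros)
  then obtain l where "lo \<le> l" "l \<le> hi" "phi v t l = 0"
    using IVT2'[of "phi v t" hi 0 lo] \<open>phi v t hi < 0\<close> \<open>phi v t lo \<ge> 0\<close> \<open>lo \<le> hi\<close> by auto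
  with hi show ?thesis
    by (intro exI[of _ l]) auto
qed

text \<open>
  Both roots give the same minimiser, so the shifted vectors are proportional.  By
  \<open>phi_neg_of_support\<close> the root \<open>l\<close> lies below some \<open>v\<^sub>i < v\<^sub>m\<^sub>a\<^sub>x\<close>; subtracting the
  proportionality relation at \<open>i\<close> from the one at a maximal index makes the factor 1.
\<close>

lemma phi_root_unique:
  fixes v :: "real ^ 'n"
  assumes "t \<ge> 0" and card: "real (card (max_indices v)) < t\<^sup>2"
    and l: "l < vmax v" "phi v t l = 0" and m: "m < vmax v" "phi v t m = 0"
  shows "m = l"
proof -
  define p where "p = norm (pos_part (v - l *\<^sub>R 1))"
  define q where "q = norm (pos_part (v - m *\<^sub>R 1))"
  have p: "p > 0" and q: "q > 0"
    using norm_pos_part_pos l m by (auto simp: p_def q_def)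
  have "pos_part (v - l *\<^sub>R 1) /\<^sub>R p = pos_part (v - m *\<^sub>R 1) /\<^sub>R q"
    using solves_P_iff_of_root[OF assms(1) l] solves_P_iff_of_root[OF assms(1) m]
    unfolding p_def q_def by blast
  then have "(pos_part (v - l *\<^sub>R 1) /\<^sub>R p) $ i = (pos_part (v - m *\<^sub>R 1) /\<^sub>R q) $ i" for i
    by simp
  then have proportional: "q * max (v $ i - l) 0 = p * max (v $ i - m) 0" for i
    using p q by (simp add: field_simps)
  obtain i where i: "i \<notin> max_indices v" "v $ i > l"
    using phi_neg_of_support[OF card l(1)] l(2) by (metis less_irrefl not_le)
  then have "p * max (v $ i - m) 0 > 0"
    using proportional[of i] q by (metis diff_gt_0_iff_gt less_max_iff_disj mult_pos_pos)
  then have "v $ i > m"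
    using p by (simp add: zero_less_mult_iff max_def split: if_splits)
  with i have at_i: "q * (v $ i - l) = p * (v $ i - m)"
    using proportional[of i] by simp
  obtain j where "v $ j = vmax v"
    using max_indices_nonempty[of v] by (auto simp: max_indices_def)
  then have at_j: "q * (vmax v - l) = p * (vmax v - m)"
    using proportional[of j] l m by simp
  have "(q - p) * (vmax v - v $ i) = 0"
    using at_i at_j by (simp add: algebra_simps)
  then have "q = p"
    using i by (auto simp: max_indices_def)
  then show "m = l"
    using at_j p by simp
qed

section \<open>The three cases\<close>

theorem theorem4p3:
  fixes v :: "real ^ 'n" and t :: real
  assumes "CARD('n) \<ge> 2"
    and "1 \<le> t" and "t < sqrt (real CARD('n))"
  shows "(real (card (max_indices v)) > t\<^sup>2 \<longrightarrow>
           (\<exists>x y. x \<noteq> y \<and> solves_P v t x \<and> solves_P v t y) \<and>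
           (\<forall>x. solves_system v t x \<longrightarrow> solves_P v t x)) \<and>
         (real (card (max_indices v)) = t\<^sup>2 \<longrightarrow>
           (let x = (\<chi> i. if i \<in> max_indices v then 1 / sqrt (real (card (max_indices v))) else 0) in
              (\<forall>y. solves_P v t y \<longleftrightarrow> y = x) \<and>
              (\<forall>y. solves_system v t y \<longleftrightarrow> y = x))) \<and>
         (real (card (max_indices v)) < t\<^sup>2 \<longrightarrow>
           (\<exists>l. (l < vmax v \<and> phi v t l = 0) \<and>
              (\<forall>m. m < vmax v \<and> phi v t m = 0 \<longrightarrow> m = l) \<and>
              (\<forall>y. solves_P v t y \<longleftrightarrow>
                 y = pos_part (v - l *\<^sub>R 1) /\<^sub>R norm (pos_part (v - l *\<^sub>R 1)))))"
proof (intro conjI impI)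
  let ?S = "max_indices v"
  have t0: "t \<ge> 0"
    using assms by simp
  {
    assume gt: "real (card ?S) > t\<^sup>2"
    have "1 \<le> t\<^sup>2"
      using assms by (simp add: one_le_power)
    with gt have card: "card ?S \<ge> 2"
      by linarith
    then obtain i j where ij: "i \<in> ?S" "j \<in> ?S" "i \<noteq> j"
      by (metis card_2_iff' obtain_subset_with_card_n subsetD)
    have sys: "solves_system v t (spike ?S t i)" "solves_system v t (spike ?S t j)"
      using ij card assms gt by (auto intro: solves_system_spike)
    then show "\<forall>x. solves_system v t x \<longrightarrow> solves_P v t x"
      using solves_P_iff_solves_system by blast
    with sys show "\<exists>x y. x \<noteq> y \<and> solves_P v t x \<and> solves_P v t y"
      using spike_inj[OF ij(1) ij(3) card] gt by blast
  next
    assume eq: "real (card ?S) = t\<^sup>2"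
    show "let x = (\<chi> i. if i \<in> ?S then 1 / sqrt (real (card ?S)) else 0) in
            (\<forall>y. solves_P v t y \<longleftrightarrow> y = x) \<and> (\<forall>y. solves_system v t y \<longleftrightarrow> y = x)"
      using solves_system_iff_uniform[OF t0 eq] solves_P_iff_solves_system[of v t]
      unfolding Let_def by blast
  next
    assume lt: "real (card ?S) < t\<^sup>2"
    obtain l where l: "l < vmax v" "phi v t l = 0"
      using phi_root_exists[OF t0 assms(3) lt] by blast
    then show "\<exists>l. (l < vmax v \<and> phi v t l = 0) \<and>
              (\<forall>m. m < vmax v \<and> phi v t m = 0 \<longrightarrow> m = l) \<and>
              (\<forall>y. solves_P v t y \<longleftrightarrow>
                 y = pos_part (v - l *\<^sub>R 1) /\<^sub>R norm (pos_part (v - l *\<^sub>R 1)))"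
      using phi_root_unique[OF t0 lt l] solves_P_iff_of_root[OF t0 l] by blast
  }
qed

end
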